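(* Let $s \geq 1$ and $t \geq 2$ be integers and let $\beta_{s,t}$ be the type-$\beta$ comb with $s$ teeth of length $t$. Then the number of linear extensions of $\beta_{s,t}$ that avoid both patterns $231$ and $312$ equals $2^{s-1}$.
   Context: A linear extension of a finite poset $P$ on a set of integers is a listing $v=[v_1,\dots,v_n]$ of all elements of $P$, each exactly once, such that whenever $a \leq_P b$, $a$ appears before $b$. For $w \in S_3$, a sequence $v$ of distinct integers contains $w$ if there are indices $i<j<k$ with $(v_i,v_j,v_k)$ in the same relative order as $(w_1,w_2,w_3)$; otherwise $v$ avoids $w$. The type-$\beta$ comb $\beta_{s,t}$ is the poset on $\{1,\dots,st\}$ whose order is generated by the relations $ct+1 \leq (c+1)t+1$ for $0 \leq c \leq s-2$ (the spine) and $ct+j \leq ct+j+1$ for $0 \leq c \leq s-1$, $1 \leq j \leq t-1$ (the teeth $\{ct+1,\dots,ct+t\}$). *)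

theory Defs
  imports Main
begin

definition appears_before :: "'a list \<Rightarrow> 'a \<Rightarrow> 'a \<Rightarrow> bool" where
  "appears_before v a b \<longleftrightarrow> (\<exists>i j. i < j \<and> j < length v \<and> v ! i = a \<and> v ! j = b)"

text \<open>The relation \<open>r\<close> is the non-strict order on the ground set \<open>A\<close>, so the condition is
  imposed on distinct elements only.\<close>

definition linear_extensions :: "'a set \<Rightarrow> 'a rel \<Rightarrow> 'a list set" where
  "linear_extensions A r =
     {v. set v = A \<and> distinct v \<and> (\<forall>(a, b) \<in> r. a \<noteq> b \<longrightarrow> appears_before v a b)}"

definition same_relative_order :: "'a::linorder list \<Rightarrow> 'b::linorder list \<Rightarrow> bool" where
  "same_relative_order xs ys \<longleftrightarrow> length xs = length ys \<and>
     (\<forall>p < length xs. \<forall>q < length xs. xs ! p < xs ! q \<longleftrightarrow> ys ! p < ys ! q)"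

text \<open>The pattern \<open>w\<close> is a permutation in \<open>S\<^sub>3\<close>, written as the list of its values.\<close>

definition contains_pattern3 :: "'a::linorder list \<Rightarrow> nat list \<Rightarrow> bool" where
  "contains_pattern3 v w \<longleftrightarrow>
     (\<exists>i j k. i < j \<and> j < k \<and> k < length v \<and> same_relative_order [v ! i, v ! j, v ! k] w)"

abbreviation avoids_pattern3 :: "'a::linorder list \<Rightarrow> nat list \<Rightarrow> bool" where
  "avoids_pattern3 v w \<equiv> \<not> contains_pattern3 v w"

definition comb_carrier :: "nat \<Rightarrow> nat \<Rightarrow> nat set" where
  "comb_carrier s t = {1..s * t}"

text \<open>The bound \<open>c \<le> s - 2\<close> is written \<open>c + 2 \<le> s\<close>, because subtraction on \<open>nat\<close> truncates:
  there is no spine relation for \<open>s = 1\<close>.\<close>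

definition comb_spine :: "nat \<Rightarrow> nat \<Rightarrow> nat rel" where
  "comb_spine s t = {(c * t + 1, (c + 1) * t + 1) | c. c + 2 \<le> s}"

definition comb_teeth :: "nat \<Rightarrow> nat \<Rightarrow> nat rel" where
  "comb_teeth s t = {(c * t + j, c * t + j + 1) | c j. c < s \<and> 1 \<le> j \<and> j < t}"

text \<open>The closure \<open>\<^sup>*\<close> is reflexive on all of \<open>nat\<close>, hence the restriction to the ground set.\<close>

definition beta_comb :: "nat \<Rightarrow> nat \<Rightarrow> nat rel" where
  "beta_comb s t =
     (comb_spine s t \<union> comb_teeth s t)\<^sup>* \<inter> (comb_carrier s t \<times> comb_carrier s t)"

lemma beta_comb_le: "(a, b) \<in> beta_comb s t \<Longrightarrow> a \<le> b"
proof -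
  assume "(a, b) \<in> beta_comb s t"
  then have "(a, b) \<in> (comb_spine s t \<union> comb_teeth s t)\<^sup>*"
    by (simp add: beta_comb_def)
  then show "a \<le> b"
    by (induction rule: rtrancl_induct) (auto simp: comb_spine_def comb_teeth_def)
qed

lemma partial_order_beta_comb: "partial_order_on (comb_carrier s t) (beta_comb s t)"
  unfolding partial_order_on_def preorder_on_def
proof (intro conjI)
  show "beta_comb s t \<subseteq> comb_carrier s t \<times> comb_carrier s t"
    by (auto simp: beta_comb_def)
  show "refl_on (comb_carrier s t) (beta_comb s t)"
    by (auto simp: refl_on_def beta_comb_def)
  show "trans (beta_comb s t)"
    by (auto simp: trans_def beta_comb_def)
  show "antisym (beta_comb s t)"
    by (auto simp: antisym_def intro!: order.antisym dest: beta_comb_le)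
qed

lemma comb_relations_subset: "comb_spine s t \<union> comb_teeth s t \<subseteq> beta_comb s t" if "t \<ge> 1"
proof -
  have less: "c * t + t \<le> s * t" if "c < s" for c
    using mult_le_mono1[of "Suc c" s t] that by simp
  have "comb_spine s t \<subseteq> comb_carrier s t \<times> comb_carrier s t"
  proof
    fix x assume "x \<in> comb_spine s t"
    then obtain c where c: "x = (c * t + 1, (c + 1) * t + 1)" "c + 2 \<le> s"
      by (auto simp: comb_spine_def)
    have "(c + 1) * t + t \<le> s * t" using less[of "c + 1"] c(2) by simp
    then show "x \<in> comb_carrier s t \<times> comb_carrier s t"
      using c(1) \<open>t \<ge> 1\<close> by (simp add: comb_carrier_def)
  qed
  moreover have "comb_teeth s t \<subseteq> comb_carrier s t \<times> comb_carrier s t"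
  proof
    fix x assume "x \<in> comb_teeth s t"
    then obtain c j where c: "x = (c * t + j, c * t + j + 1)" "c < s" "1 \<le> j" "j < t"
      by (auto simp: comb_teeth_def)
    then show "x \<in> comb_carrier s t \<times> comb_carrier s t"
      using less[OF c(2)] by (simp add: comb_carrier_def)
  qed
  ultimately show ?thesis
    unfolding beta_comb_def by blast
qed

end

theory Submission
  imports Defs
begin

text \<open>
  Suppose a linear extension avoiding \<open>231\<close> and \<open>312\<close> lists \<open>b\<close> before \<open>a\<close> although \<open>a < b\<close>. Then
  every value strictly between \<open>a\<close> and \<open>b\<close> is listed between them, so \<open>[a, b]\<close> is listed in
  decreasing order. A tooth forbids \<open>m + 1\<close> before \<open>m\<close> unless \<open>t\<close> divides \<open>m\<close>, and \<open>t \<ge> 2\<close>, so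
  \<open>b = a + 1\<close> and \<open>t\<close> divides \<open>a\<close>. Hence the extension arises from the identity by swapping \<open>m\<close>
  and \<open>m + 1\<close> for all \<open>m\<close> in a set of multiples of \<open>t\<close> in \<open>[t, (s - 1) t]\<close>; conversely every one
  of the \<open>2 ^ (s - 1)\<close> such sets gives an extension of the required kind.
\<close>

section \<open>Patterns and precedence in a list\<close>

lemma same_relative_order_231:
  "same_relative_order [x, y, z] [2, 3, 1 :: nat] \<longleftrightarrow> z < x \<and> x < y"
  unfolding same_relative_order_def by (auto simp: numeral_3_eq_3 All_less_Suc)

lemma same_relative_order_312:
  "same_relative_order [x, y, z] [3, 1, 2 :: nat] \<longleftrightarrow> y < z \<and> z < x"
  unfolding same_relative_order_def by (auto simp: numeral_3_eq_3 All_less_Suc)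

lemma appears_before_total:
  assumes "a \<in> set v" "b \<in> set v" "a \<noteq> b"
  shows "appears_before v a b \<or> appears_before v b a"
  using assms unfolding appears_before_def in_set_conv_nth by (metis nat_neq_iff)

lemma appears_before_asym:
  assumes "distinct v" "appears_before v a b"
  shows "\<not> appears_before v b a"
  using assms unfolding appears_before_def
  by (metis less_trans nth_eq_iff_index_eq not_less_iff_gr_or_eq)

lemma contains_pattern3I:
  assumes "distinct v" "appears_before v x y" "appears_before v y z"
    and "same_relative_order [x, y, z] w"
  shows "contains_pattern3 v w"
proof -
  obtain i j where i: "i < j" "j < length v" "v ! i = x" "v ! j = y"
    using assms(2) unfolding appears_before_def by blast
  obtain j' k where j: "j' < k" "k < length v" "v ! j' = y" "v ! k = z"
    using assms(3) unfolding appears_before_def by blast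
  have "j' = j"
    using i j assms(1) by (metis less_trans nth_eq_iff_index_eq)
  then show ?thesis
    using i j assms(4) unfolding contains_pattern3_def by blast
qed

text \<open>If \<open>m\<close> came before \<open>b\<close>, then \<open>m\<close>,
  \<open>b\<close>, \<open>a\<close> would form 231; if \<open>m\<close> came after
  \<open>a\<close>, then \<open>b\<close>, \<open>a\<close>, \<open>m\<close> would form
  312.\<close>

lemma inversion_between:
  assumes "distinct v" "avoids_pattern3 v [2, 3, 1]" "avoids_pattern3 v [3, 1, 2]"
    and "appears_before v b a" "a < m" "m < b" "m \<in> set v"
  shows "appears_before v b m \<and> appears_before v m a"
proof -
  have ab: "a \<in> set v" "b \<in> set v"
    using assms(4) unfolding appears_before_def by (auto intro: nth_mem)
  have "\<not> appears_before v m b"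
    using contains_pattern3I[OF assms(1) _ assms(4)] assms(2,5,6) same_relative_order_231 by blast
  moreover have "\<not> appears_before v a m"
    using contains_pattern3I[OF assms(1,4)] assms(3,5,6) same_relative_order_312 by blast
  ultimately show ?thesis
    using appears_before_total ab assms(5-7) by (metis less_irrefl)
qed

section \<open>Products of disjoint adjacent transpositions\<close>

definition swap_succ :: "nat set \<Rightarrow> nat \<Rightarrow> nat" where
  "swap_succ E i = (if i \<in> E then Suc i else if i - 1 \<in> E then i - 1 else i)"

text \<open>Makes the transpositions of \<open>m\<close> and \<open>m + 1\<close> for
  \<open>m\<close> in \<open>E\<close> pairwise disjoint, so that \<open>swap_succ E\<close> is
  their product and an involution.\<close>

definition sparse :: "nat set \<Rightarrow> bool" where
  "sparse E \<longleftrightarrow> 0 \<notin> E \<and> (\<forall>i\<in>E. Suc i \<notin> E)"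

lemma swap_succ_le: "swap_succ E i \<le> Suc i"
  and swap_succ_ge: "i \<le> Suc (swap_succ E i)"
  by (auto simp: swap_succ_def)

lemma swap_succ_eq_Suc_iff: "swap_succ E i = Suc i \<longleftrightarrow> i \<in> E"
  by (auto simp: swap_succ_def)

lemma swap_succ_swap_succ:
  assumes "sparse E"
  shows "swap_succ E (swap_succ E i) = i"
proof (cases "i \<in> E")
  case False
  then show ?thesis
    using assms by (cases i) (auto simp: swap_succ_def sparse_def)
qed (use assms in \<open>auto simp: swap_succ_def sparse_def\<close>)

lemma inj_swap_succ:
  assumes "sparse E"
  shows "inj (swap_succ E)"
  by (metis assms injI swap_succ_swap_succ)

lemma swap_succ_in_interval:
  assumes "sparse E" "E \<subseteq> {1..<n}" "i \<in> {1..n}"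
  shows "swap_succ E i \<in> {1..n}"
proof -
  have "Suc i \<le> n" if "i \<in> E"
    using that assms(2) by auto
  moreover have "1 \<le> i - 1" if "i - 1 \<in> E"
    using that assms(2) by auto
  ultimately show ?thesis
    using assms(3) by (auto simp: swap_succ_def)
qed

lemma swap_succ_image:
  assumes "sparse E" "E \<subseteq> {1..<n}"
  shows "swap_succ E ` {1..n} = {1..n}"
proof
  show "swap_succ E ` {1..n} \<subseteq> {1..n}"
    using swap_succ_in_interval[OF assms] by blast
  show "{1..n} \<subseteq> swap_succ E ` {1..n}"
    using swap_succ_in_interval[OF assms] swap_succ_swap_succ[OF assms(1)]
    by (metis imageI subsetI)
qed

text \<open>In both patterns the first entry exceeds the last. But an occurrence at indices
  \<open>i < j < k\<close> has \<open>i + 2 \<le> k\<close>, so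
  \<open>v ! i \<le> i + 2 \<le> k \<le> v ! k\<close>.\<close>

lemma avoids_pattern3_if_near_identity:
  assumes "\<And>i. i < length v \<Longrightarrow> v ! i \<le> i + 2 \<and> i \<le> v ! i"
  shows "avoids_pattern3 v [2, 3, 1]" "avoids_pattern3 v [3, 1, 2]"
proof -
  have less: "v ! i \<le> v ! k" if "i < j" "j < k" "k < length v" for i j k
    using assms[of i] assms[of k] that by linarith
  show "avoids_pattern3 v [2, 3, 1]" "avoids_pattern3 v [3, 1, 2]"
    unfolding contains_pattern3_def same_relative_order_231 same_relative_order_312
    by (meson less leD)+
qed

lemma appears_before_swap_succ:
  assumes "sparse E" "E \<subseteq> {1..<n}" "a \<in> {1..n}" "b \<in> {1..n}"
    and "swap_succ E a < swap_succ E b"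
  shows "appears_before (map (swap_succ E) [1..<Suc n]) a b"
proof -
  \<comment> \<open>By the involution, \<open>x\<close> is the entry number
    \<open>swap_succ E x\<close>; the shift by one is there because \<open>nth\<close> counts from 0
    and the list starts at 1.\<close>
  have pos: "map (swap_succ E) [1..<Suc n] ! (swap_succ E x - 1) = x \<and>
      swap_succ E x - 1 < n \<and> 1 \<le> swap_succ E x" if "x \<in> {1..n}" for x
    using swap_succ_in_interval[OF assms(1,2) that] swap_succ_swap_succ[OF assms(1), of x]
    by (auto simp: nth_append simp del: upt_Suc)
  show ?thesis
    unfolding appears_before_def
    using pos[OF assms(3)] pos[OF assms(4)] assms(5)
    by (intro exI[of _ "swap_succ E a - 1"] exI[of _ "swap_succ E b - 1"])
      (auto simp del: upt_Suc)
qed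

section \<open>Linear extensions of the comb\<close>

lemma appears_before_comb_tooth:
  assumes "v \<in> linear_extensions (comb_carrier s t) (beta_comb s t)"
    and "1 \<le> m" "m < s * t" "\<not> t dvd m"
  shows "appears_before v m (Suc m)"
proof -
  have t: "t \<ge> 1"
    using assms(3) by (cases t) auto
  have "m div t < s" "1 \<le> m mod t" "m mod t < t"
    using assms t by (auto simp: less_mult_imp_div_less Suc_le_eq mod_greater_zero_iff_not_dvd)
  then have "(m div t * t + m mod t, m div t * t + m mod t + 1) \<in> comb_teeth s t"
    unfolding comb_teeth_def by blast
  then have "(m, Suc m) \<in> beta_comb s t"
    using comb_relations_subset[OF t] by auto
  then show ?thesis
    using assms(1) by (fastforce simp: linear_extensions_def)
qed

lemma inversion_in_comb_extension:
  assumes v: "v \<in> linear_extensions (comb_carrier s t) (beta_comb s t)"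
    and av: "avoids_pattern3 v [2, 3, 1]" "avoids_pattern3 v [3, 1, 2]"
    and "t \<ge> 2" and ba: "appears_before v b a" and "a < b"
  shows "b = Suc a \<and> t dvd a"
proof -
  have d: "distinct v" and set_v: "set v = {1..s * t}"
    using v by (auto simp: linear_extensions_def comb_carrier_def)
  have "a \<in> set v" "b \<in> set v"
    using ba unfolding appears_before_def by (auto intro: nth_mem)
  then have a: "1 \<le> a" and b: "b \<le> s * t"
    using set_v by auto
  have dvd: "t dvd m" if "a \<le> m" "m < b" for m
  proof (rule ccontr)
    assume "\<not> t dvd m"
    then have before: "appears_before v m (Suc m)"
      using appears_before_comb_tooth[OF v] a b that by auto
    \<comment> \<open>\<open>inversion_between\<close> is used twice: first on \<open>b\<close>
      before \<open>a\<close>, to get \<open>b\<close> before \<open>m\<close>, then on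
      \<open>b\<close> before \<open>m\<close>, to get \<open>Suc m\<close> before
      \<open>m\<close>.\<close>
    have am: "m = a \<or> appears_before v b m"
      using inversion_between[OF d av ba, of m] that set_v a b by force
    then have bm: "appears_before v b m"
      using ba by blast
    have "appears_before v (Suc m) m"
    proof (cases "Suc m = b")
      case False
      then show ?thesis
        using inversion_between[OF d av bm, of "Suc m"] that set_v a b by force
    qed (use bm in simp)
    then show False
      using before appears_before_asym[OF d] by blast
  qed
  have "b = Suc a"
  proof (rule ccontr)
    assume "b \<noteq> Suc a"
    then have "t dvd a" "t dvd Suc a"
      using dvd[of a] dvd[of "Suc a"] \<open>a < b\<close> by auto
    then have "t dvd 1"
      using dvd_diff_nat[of t "Suc a" a] by simp
    then show False
      using \<open>t \<ge> 2\<close> by simp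
  qed
  then show ?thesis
    using dvd[of a] by simp
qed

text \<open>For \<open>m = c * t\<close>, the values \<open>m\<close> and \<open>m + 1\<close> are
  the top of one tooth and the base of the next one, which are incomparable for
  \<open>t \<ge> 2\<close>. There are \<open>s - 1\<close> such boundaries.\<close>

definition comb_swaps :: "nat \<Rightarrow> nat \<Rightarrow> nat set" where
  "comb_swaps s t = (\<lambda>c. c * t) ` {1..<s}"

lemma comb_swaps_iff:
  assumes "t \<ge> 1"
  shows "m \<in> comb_swaps s t \<longleftrightarrow> 1 \<le> m \<and> m < s * t \<and> t dvd m"
  using assms by (auto simp: comb_swaps_def image_iff dvd_def mult.commute Bex_def)

lemma card_Pow_comb_swaps:
  assumes "t \<ge> 1"
  shows "card (Pow (comb_swaps s t)) = 2 ^ (s - 1)"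
proof -
  have "inj_on (\<lambda>c. c * t) {1..<s}"
    using assms by (auto simp: inj_on_def)
  then show ?thesis
    by (simp add: comb_swaps_def card_Pow card_image)
qed

lemma
  assumes "t \<ge> 2" "E \<subseteq> comb_swaps s t"
  shows sparse_comb_swaps: "sparse E" and comb_swaps_interval: "E \<subseteq> {1..<s * t}"
proof -
  have iff: "1 \<le> m \<and> m < s * t \<and> t dvd m" if "m \<in> E" for m
    using that assms comb_swaps_iff[of t m s] by auto
  then show "E \<subseteq> {1..<s * t}"
    by auto
  have "Suc m \<notin> E" if "m \<in> E" for m
  proof
    assume "Suc m \<in> E"
    then have "t dvd Suc m - m"
      using iff that by (intro dvd_diff_nat) auto
    then show False
      using assms(1) by simp
  qed
  then show "sparse E"
    using iff unfolding sparse_def by force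
qed

text \<open>Positions respect the order: a spine step raises the value by \<open>t \<ge> 2\<close>
  while each value moves by at most one, and a tooth step starts at a non-multiple of
  \<open>t\<close>, so its two values are not swapped. Strictness for distinct elements follows
  later from injectivity.\<close>

lemma swap_succ_mono_comb:
  assumes "t \<ge> 2" "E \<subseteq> comb_swaps s t"
    and "(a, b) \<in> (comb_spine s t \<union> comb_teeth s t)\<^sup>*"
  shows "swap_succ E a \<le> swap_succ E b"
  using assms(3)
proof (induction rule: rtrancl_induct)
  case (step x y)
  have "swap_succ E x \<le> swap_succ E y"
  proof (cases "(x, y) \<in> comb_spine s t")
    case True
    then have "x + 2 \<le> y"
      using assms(1) by (auto simp: comb_spine_def)
    then show ?thesis
      using swap_succ_le[of E x] swap_succ_ge[of y E] by linarith
  next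
    case False
    then obtain c j where x: "x = c * t + j" "1 \<le> j" "j < t" and y: "y = Suc x"
      using step.hyps(2) by (auto simp: comb_teeth_def)
    have "\<not> t dvd x"
      using x by (auto simp: dvd_add_right_iff dest: dvd_imp_le)
    then have "x \<notin> E"
      using assms comb_swaps_iff[of t x s] by auto
    then show ?thesis
      using swap_succ_ge[of y E] y by (auto simp: swap_succ_def)
  qed
  then show ?case
    using step.IH by linarith
qed simp

lemma swap_succ_list_extension:
  assumes "t \<ge> 2" "E \<subseteq> comb_swaps s t"
  defines "v \<equiv> map (swap_succ E) [1..<Suc (s * t)]"
  shows "v \<in> linear_extensions (comb_carrier s t) (beta_comb s t)"
    and "avoids_pattern3 v [2, 3, 1]" and "avoids_pattern3 v [3, 1, 2]"
proof -
  note E = sparse_comb_swaps[OF assms(1,2)] comb_swaps_interval[OF assms(1,2)]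
  have "set v = {1..s * t}"
    using swap_succ_image[OF E] by (simp add: v_def atLeastLessThanSuc_atLeastAtMost del: upt_Suc)
  moreover have "distinct v"
    using inj_swap_succ[OF E(1)] by (auto simp: v_def distinct_map inj_on_def inj_def simp del: upt_Suc)
  moreover have "appears_before v a b" if "(a, b) \<in> beta_comb s t" "a \<noteq> b" for a b
  proof -
    have ab: "a \<in> {1..s * t}" "b \<in> {1..s * t}"
      using that(1) by (auto simp: beta_comb_def comb_carrier_def)
    have "swap_succ E a \<le> swap_succ E b"
      using swap_succ_mono_comb[OF assms(1,2)] that(1) by (simp add: beta_comb_def)
    then have "swap_succ E a < swap_succ E b"
      using that(2) inj_swap_succ[OF E(1)] by (metis injD le_neq_implies_less)
    then show ?thesis
      unfolding v_def using appears_before_swap_succ[OF E ab] by blast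
  qed
  ultimately show "v \<in> linear_extensions (comb_carrier s t) (beta_comb s t)"
    by (auto simp: linear_extensions_def comb_carrier_def)
  have "v ! i \<le> i + 2 \<and> i \<le> v ! i" if "i < length v" for i
    using that swap_succ_le[of E "Suc i"] swap_succ_ge[of "Suc i" E]
    by (simp add: v_def del: upt_Suc)
  then show "avoids_pattern3 v [2, 3, 1]" "avoids_pattern3 v [3, 1, 2]"
    using avoids_pattern3_if_near_identity[of v] by blast+
qed

lemma comb_extension_eq_swap_succ_list:
  assumes v: "v \<in> linear_extensions (comb_carrier s t) (beta_comb s t)"
    and av: "avoids_pattern3 v [2, 3, 1]" "avoids_pattern3 v [3, 1, 2]"
    and t: "t \<ge> 2"
  shows "\<exists>E \<subseteq> comb_swaps s t. v = map (swap_succ E) [1..<Suc (s * t)]"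
proof -
  \<comment> \<open>\<open>E\<close> collects the tooth boundaries that \<open>v\<close> reverses;
    by \<open>inversion_in_comb_extension\<close> these account for all inversions of
    \<open>v\<close>.\<close>
  define E where "E = {m \<in> comb_swaps s t. appears_before v (Suc m) m}"
  have sub: "E \<subseteq> comb_swaps s t"
    by (auto simp: E_def)
  note E = sparse_comb_swaps[OF t sub] comb_swaps_interval[OF t sub]
  have d: "distinct v" and set_v: "set v = {1..s * t}"
    using v by (auto simp: linear_extensions_def comb_carrier_def)
  have less: "swap_succ E a < swap_succ E b" if ab: "appears_before v a b" for a b
  proof -
    have mem: "a \<in> set v" "b \<in> set v"
      using ab unfolding appears_before_def by (auto intro: nth_mem)
    have "\<not> appears_before v b a"
      using appears_before_asym[OF d ab] .
    then have neq: "a \<noteq> b"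
      using ab by blast
    show ?thesis
    proof (cases "a < b")
      case True
      have "swap_succ E a \<le> swap_succ E b"
      proof (cases "b = Suc a")
        case True
        then have "a \<notin> E"
          using \<open>\<not> appears_before v b a\<close> by (auto simp: E_def)
        then show ?thesis
          using True swap_succ_ge[of b E] by (auto simp: swap_succ_def)
      next
        case False
        then show ?thesis
          using \<open>a < b\<close> swap_succ_le[of E a] swap_succ_ge[of b E] by linarith
      qed
      then show ?thesis
        using neq inj_swap_succ[OF E(1)] by (metis injD le_neq_implies_less)
    next
      case False
      then have "b < a"
        using neq by simp
      then have a: "a = Suc b" "t dvd b"
        using inversion_in_comb_extension[OF v av t ab] by auto
      then have "b \<in> E"
        using ab mem set_v t by (auto simp: E_def comb_swaps_iff)
      then show ?thesis
        using a E(1) by (auto simp: swap_succ_def sparse_def)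
    qed
  qed
  \<comment> \<open>Applying \<open>swap_succ E\<close> to the entries of \<open>v\<close> undoes
    all its inversions, which leaves the increasing list; the involution then recovers
    \<open>v\<close>.\<close>
  have "sorted_wrt (<) (map (swap_succ E) v)"
    unfolding sorted_wrt_iff_nth_less using less by (auto simp: appears_before_def)
  moreover have "set (map (swap_succ E) v) = set [1..<Suc (s * t)]"
    using swap_succ_image[OF E] set_v
    by (simp add: atLeastLessThanSuc_atLeastAtMost del: upt_Suc)
  ultimately have "map (swap_succ E) v = [1..<Suc (s * t)]"
    by (intro strict_sorted_equal) (auto simp del: upt_Suc)
  then have "map (swap_succ E) [1..<Suc (s * t)] = map (swap_succ E) (map (swap_succ E) v)"
    by simp
  also have "\<dots> = v"
    by (simp add: swap_succ_swap_succ[OF E(1)] map_idI)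
  finally show ?thesis
    using sub by metis
qed

text \<open>\<open>E\<close> can be read off the list: \<open>i\<close> lies in \<open>E\<close>
  exactly when the entry number \<open>i\<close> is \<open>Suc i\<close>.\<close>

lemma inj_on_swap_succ_list:
  "inj_on (\<lambda>E. map (swap_succ E) [1..<Suc n]) (Pow {1..n})"
proof (rule inj_onI)
  fix E F
  assume EF: "E \<in> Pow {1..n}" "F \<in> Pow {1..n}"
    and "map (swap_succ E) [1..<Suc n] = map (swap_succ F) [1..<Suc n]"
  then have "swap_succ E i = swap_succ F i" if "i \<in> {1..n}" for i
    using that by (auto simp: map_eq_conv simp del: upt_Suc)
  then have "i \<in> E \<longleftrightarrow> i \<in> F" if "i \<in> {1..n}" for i
    using that by (metis swap_succ_eq_Suc_iff)
  then show "E = F"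
    using EF by blast
qed

theorem theorem20:
  fixes s t :: nat
  assumes "s \<ge> 1" and "t \<ge> 2"
  shows "card {v \<in> linear_extensions (comb_carrier s t) (beta_comb s t).
           avoids_pattern3 v [2, 3, 1] \<and> avoids_pattern3 v [3, 1, 2]} = 2 ^ (s - 1)"
    (is "card ?S = _")
proof -
  let ?list = "\<lambda>E. map (swap_succ E) [1..<Suc (s * t)]"
  have "?S = ?list ` Pow (comb_swaps s t)"
  proof
    show "?S \<subseteq> ?list ` Pow (comb_swaps s t)"
      using comb_extension_eq_swap_succ_list[OF _ _ _ assms(2)] by blast
    show "?list ` Pow (comb_swaps s t) \<subseteq> ?S"
      using swap_succ_list_extension[OF assms(2)] by blast
  qed
  moreover have "inj_on ?list (Pow (comb_swaps s t))"
    using comb_swaps_interval[OF assms(2) subset_refl, of s]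
    by (intro inj_on_subset[OF inj_on_swap_succ_list]) auto
  ultimately show ?thesis
    using card_Pow_comb_swaps[of t s] assms(2) by (simp add: card_image del: upt_Suc)
qed

end
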